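(* Let $n\in\mathbb{Z}\setminus\{0\}$, $a\in\mathbb{C}\setminus\{0\}$, $\alpha,\beta\in\mathbb{C}$, and let $\delta:V(\alpha,\beta)\to V(\alpha,\beta)$ be a linear map. Then $(V(\alpha,\beta),\delta)$ is a $1$-differential module over $(\mathrm{Vir},d_{n,a})$ if and only if $(n-1)\alpha\in\mathbb{Z}$ and $\delta$ is defined by $\delta(v_i)=\xi a^iv_{(n-1)\alpha+ni}-v_i$ (for all $i\in\mathbb{Z}$) for some $\xi\in\mathbb{C}$.
   Context: All spaces and algebras are over $\mathbb{C}$ and all linear maps are $\mathbb{C}$-linear. For a Lie algebra $\mathcal{L}$, a $1$-differential operator on $\mathcal{L}$ is a linear map $d:\mathcal{L}\to\mathcal{L}$ such that $d[x,y]=[d(x),y]+[x,d(y)]+[d(x),d(y)]$ for all $x,y\in\mathcal{L}$. A $1$-differential module over $(\mathcal{L},d)$ is a pair $(V,\delta)$ where $V$ is an $\mathcal{L}$-module and $\delta:V\to V$ is a linear map with $\delta(xv)=d(x)v+x\delta(v)+d(x)\delta(v)$ for all $x\in\mathcal{L}$, $v\in V$. (The map $\delta=-\mathrm{id}_V$ always satisfies this; it is called the trivial $1$-differential module structure.) The Virasoro algebra $\mathrm{Vir}$ is the complex Lie algebra with basis $\{L_n, C \mid n\in\mathbb{Z}\}$ and brackets $[L_m,L_n]=(n-m)L_{n+m}+\delta_{n,-m}\frac{m^3-m}{12}C$, $[C,L_m]=0$. For $n\in\mathbb{Z}\setminus\{0\}$, $a\in\mathbb{C}\setminus\{0\}$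 the $1$-differential operator $d_{n,a}$ on $\mathrm{Vir}$ is given by $d_{n,a}(L_i)=\frac{a^i}{n}\left(L_{ni}-\delta_{i,0}\frac{n^2-1}{24}C\right)-L_i$ and $d_{n,a}(C)=nC-C$. For $\alpha,\beta\in\mathbb{C}$, the module of intermediate series $V(\alpha,\beta)$ is the $\mathrm{Vir}$-module with basis $\{v_i\mid i\in\mathbb{Z}\}$ and action $L_iv_j=(\alpha+j+\beta i)v_{i+j}$, $Cv_j=0$ for $i,j\in\mathbb{Z}$.
   Formalization: The right-hand side gains the alternative δ = −id (trivial structure), which is always a 1-differential module, so the stated equivalence fails for δ = −id when (n−1)α is not an integer (e.g. n=2, a=1, α=1/2); otherwise the claim is unchanged. *)

theory Defs
  imports Complex_Main "HOL-Library.Poly_Mapping"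
begin

locale lie_algebra = vector_space scale
  for scale :: "complex \<Rightarrow> 'l::ab_group_add \<Rightarrow> 'l" +
  fixes bracket :: "'l \<Rightarrow> 'l \<Rightarrow> 'l"
  assumes bracket_linear_left: "Vector_Spaces.linear scale scale (\<lambda>x. bracket x y)"
    and bracket_linear_right: "Vector_Spaces.linear scale scale (\<lambda>y. bracket x y)"
    and bracket_self: "bracket x x = 0"
    and jacobi: "bracket x (bracket y z) + bracket y (bracket z x) + bracket z (bracket x y) = 0"

locale lie_module = lie_algebra scaleL bracket + V: vector_space scaleV
  for scaleL :: "complex \<Rightarrow> 'l::ab_group_add \<Rightarrow> 'l"
    and bracket :: "'l \<Rightarrow> 'l \<Rightarrow> 'l"
    and scaleV :: "complex \<Rightarrow> 'v::ab_group_add \<Rightarrow> 'v" +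
  fixes act :: "'l \<Rightarrow> 'v \<Rightarrow> 'v"
  assumes act_linear_left: "Vector_Spaces.linear scaleL scaleV (\<lambda>x. act x v)"
    and act_linear_right: "Vector_Spaces.linear scaleV scaleV (\<lambda>v. act x v)"
    and act_bracket: "act (bracket x y) v = act x (act y v) - act y (act x v)"

locale one_diff_operator = lie_algebra scale bracket
  for scale :: "complex \<Rightarrow> 'l::ab_group_add \<Rightarrow> 'l"
    and bracket :: "'l \<Rightarrow> 'l \<Rightarrow> 'l" +
  fixes d :: "'l \<Rightarrow> 'l"
  assumes d_linear: "Vector_Spaces.linear scale scale d"
    and d_bracket: "d (bracket x y) = bracket (d x) y + bracket x (d y) + bracket (d x) (d y)"

locale one_diff_module =
  one_diff_operator scaleL bracket d + lie_module scaleL bracket scaleV act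
  for scaleL :: "complex \<Rightarrow> 'l::ab_group_add \<Rightarrow> 'l"
    and bracket :: "'l \<Rightarrow> 'l \<Rightarrow> 'l"
    and d :: "'l \<Rightarrow> 'l"
    and scaleV :: "complex \<Rightarrow> 'v::ab_group_add \<Rightarrow> 'v"
    and act :: "'l \<Rightarrow> 'v \<Rightarrow> 'v" +
  fixes \<delta> :: "'v \<Rightarrow> 'v"
  assumes delta_linear: "Vector_Spaces.linear scaleV scaleV \<delta>"
    and delta_act: "\<delta> (act x v) = act (d x) v + act x (\<delta> v) + act (d x) (\<delta> v)"

text \<open>The complex vector space with basis indexed by \<open>'i\<close> is the type \<open>'i \<Rightarrow>\<^sub>0 complex\<close> of
  finitely supported functions; the basis vector with index \<open>i\<close> is \<open>Poly_Mapping.single i 1\<close>.\<close>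

definition cscale :: "complex \<Rightarrow> ('i \<Rightarrow>\<^sub>0 complex) \<Rightarrow> ('i \<Rightarrow>\<^sub>0 complex)"  (infixr \<open>*\<^sub>c\<close> 75)
  where "c *\<^sub>c p = Poly_Mapping.map ((*) c) p"

definition lin_extend :: "('i \<Rightarrow> 'j \<Rightarrow>\<^sub>0 complex) \<Rightarrow> ('i \<Rightarrow>\<^sub>0 complex) \<Rightarrow> ('j \<Rightarrow>\<^sub>0 complex)"
  where "lin_extend f p = (\<Sum>i\<in>Poly_Mapping.keys p. Poly_Mapping.lookup p i *\<^sub>c f i)"

definition bilin_extend ::
    "('i \<Rightarrow> 'j \<Rightarrow> 'k \<Rightarrow>\<^sub>0 complex) \<Rightarrow> ('i \<Rightarrow>\<^sub>0 complex) \<Rightarrow> ('j \<Rightarrow>\<^sub>0 complex) \<Rightarrow> ('k \<Rightarrow>\<^sub>0 complex)"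
  where "bilin_extend f p q = lin_extend (\<lambda>i. lin_extend (f i) q) p"

datatype vir_index = L_index int | C_index

type_synonym vir = "vir_index \<Rightarrow>\<^sub>0 complex"

definition vir_L :: "int \<Rightarrow> vir"
  where "vir_L n = Poly_Mapping.single (L_index n) 1"

definition vir_C :: vir
  where "vir_C = Poly_Mapping.single C_index 1"

fun vir_bracket_basis :: "vir_index \<Rightarrow> vir_index \<Rightarrow> vir"
  where
    "vir_bracket_basis (L_index m) (L_index n) =
       of_int (n - m) *\<^sub>c vir_L (n + m) + (if n = - m then (of_int (m ^ 3 - m) / 12) *\<^sub>c vir_C else 0)"
  | "vir_bracket_basis C_index _ = 0"
  | "vir_bracket_basis _ C_index = 0"

definition vir_bracket :: "vir \<Rightarrow> vir \<Rightarrow> vir"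
  where "vir_bracket = bilin_extend vir_bracket_basis"

fun vir_d_basis :: "int \<Rightarrow> complex \<Rightarrow> vir_index \<Rightarrow> vir"
  where
    "vir_d_basis n a (L_index i) =
       (a powi i / of_int n) *\<^sub>c
         (vir_L (n * i) - (if i = 0 then (of_int (n\<^sup>2 - 1) / 24) *\<^sub>c vir_C else 0)) - vir_L i"
  | "vir_d_basis n a C_index = of_int n *\<^sub>c vir_C - vir_C"

definition vir_d :: "int \<Rightarrow> complex \<Rightarrow> vir \<Rightarrow> vir"
  where "vir_d n a = lin_extend (vir_d_basis n a)"

text \<open>The underlying space of \<open>V(\<alpha>, \<beta>)\<close> does not depend on the parameters; only the action
  \<open>series_act \<alpha> \<beta>\<close> does.\<close>

type_synonym series = "int \<Rightarrow>\<^sub>0 complex"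

definition v_basis :: "int \<Rightarrow> series"
  where "v_basis i = Poly_Mapping.single i 1"

fun series_act_basis :: "complex \<Rightarrow> complex \<Rightarrow> vir_index \<Rightarrow> int \<Rightarrow> series"
  where
    "series_act_basis \<alpha> \<beta> (L_index i) j = (\<alpha> + of_int j + \<beta> * of_int i) *\<^sub>c v_basis (i + j)"
  | "series_act_basis \<alpha> \<beta> C_index j = 0"

definition series_act :: "complex \<Rightarrow> complex \<Rightarrow> vir \<Rightarrow> series \<Rightarrow> series"
  where "series_act \<alpha> \<beta> = bilin_extend (series_act_basis \<alpha> \<beta>)"

end

theory Submission
  imports Defs
begin

text \<open>
  Put \<open>\<phi> = d + id\<close> and \<open>D = \<delta> + id\<close>. Expanding the products shows that \<open>d\<close> is a
  1-differential operator exactly when \<open>\<phi>\<close> is a Lie algebra endomorphism, and that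
  \<open>\<delta>\<close> satisfies the 1-differential module identity exactly when \<open>D (x v) = \<phi> x (D v)\<close>,
  that is, when \<open>D\<close> is \<open>\<phi>\<close>-semilinear. The endomorphism here is
  \<open>\<phi> L\<^sub>i = (a\<^sup>i / n) L\<^sub>n\<^sub>i\<close> up to a central term at \<open>i = 0\<close>, with \<open>\<phi> C = n C\<close>; the central
  term corrects the cocycle of the rescaled generators (\<open>vir_hom_bracket\<close>).

  As \<open>C\<close> acts by zero, semilinearity is the family of equations
  \<open>(\<alpha> + j + \<beta> i) D v\<^bsub>i+j\<^esub> = (a\<^sup>i / n) L\<^sub>n\<^sub>i (D v\<^sub>j)\<close> (\<open>one_diff_module_iff_basis\<close>).
  For \<open>i = 0\<close> they say that \<open>D v\<^sub>j\<close> is an eigenvector of \<open>L\<^sub>0\<close> with eigenvalue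
  \<open>n (\<alpha> + j)\<close>. Since \<open>L\<^sub>0 v\<^sub>k = (\<alpha> + k) v\<^sub>k\<close>, the only basis vector that \<open>D v\<^sub>j\<close> can
  involve has index \<open>k = (n - 1) \<alpha> + n j\<close>. So either \<open>D = 0\<close>, the trivial structure, or
  \<open>m = (n - 1) \<alpha>\<close> is an integer and \<open>D v\<^sub>j = c\<^sub>j v\<^bsub>m+nj\<^esub>\<close>. With \<open>g\<^sub>j = c\<^sub>j / a\<^sup>j\<close> the remaining
  equations become \<open>(\<alpha> + j + \<beta> (k - j)) (g\<^sub>k - g\<^sub>j) = 0\<close>, which force \<open>g\<close> to be constant for
  all values of \<open>\<alpha>\<close> and \<open>\<beta>\<close> (\<open>constant_if_weighted_differences_vanish\<close>); the constant is \<open>\<xi>\<close>.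
\<close>

section \<open>Linear algebra with a distinguished basis\<close>

lemma lookup_cscale [simp]: "Poly_Mapping.lookup (c *\<^sub>c p) i = c * Poly_Mapping.lookup p i"
  by (simp add: cscale_def map.rep_eq when_def)

interpretation cs: vector_space "cscale :: complex \<Rightarrow> ('i \<Rightarrow>\<^sub>0 complex) \<Rightarrow> 'i \<Rightarrow>\<^sub>0 complex"
  by unfold_locales (auto intro!: poly_mapping_eqI simp: lookup_add algebra_simps)

lemma linear_cscale_iff:
  "Vector_Spaces.linear cscale cscale f \<longleftrightarrow>
    (\<forall>x y. f (x + y) = f x + f y) \<and> (\<forall>c x. f (c *\<^sub>c x) = c *\<^sub>c f x)"
  by (simp add: Vector_Spaces.linear_def module_hom_def module_hom_axioms_def
      cs.vector_space_axioms cs.module_axioms)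

lemma lin_extend_superset:
  assumes "finite S" "Poly_Mapping.keys p \<subseteq> S"
  shows "lin_extend f p = (\<Sum>i\<in>S. Poly_Mapping.lookup p i *\<^sub>c f i)"
  unfolding lin_extend_def
  by (rule sum.mono_neutral_left) (use assms in \<open>auto simp: in_keys_iff\<close>)

lemma lin_extend_add: "lin_extend f (p + q) = lin_extend f p + lin_extend f q"
proof -
  let ?S = "Poly_Mapping.keys p \<union> Poly_Mapping.keys q"
  have "lin_extend f r = (\<Sum>i\<in>?S. Poly_Mapping.lookup r i *\<^sub>c f i)"
    if "r \<in> {p, q, p + q}" for r
    using that keys_add[of p q] by (intro lin_extend_superset) auto
  then show ?thesis
    by (simp add: lookup_add cs.scale_left_distrib sum.distrib)
qed

lemma lin_extend_scale: "lin_extend f (c *\<^sub>c p) = c *\<^sub>c lin_extend f p"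
proof -
  have "Poly_Mapping.keys (c *\<^sub>c p) \<subseteq> Poly_Mapping.keys p"
    by (auto simp: in_keys_iff)
  then have "lin_extend f (c *\<^sub>c p)
      = (\<Sum>i\<in>Poly_Mapping.keys p. Poly_Mapping.lookup (c *\<^sub>c p) i *\<^sub>c f i)"
    by (intro lin_extend_superset) auto
  then show ?thesis
    by (simp add: lin_extend_def cs.scale_sum_right)
qed

lemma lin_extend_single [simp]: "lin_extend f (Poly_Mapping.single i 1) = f i"
  by (simp add: lin_extend_def)

lemma bilin_extend_single [simp]:
  "bilin_extend f (Poly_Mapping.single i 1) (Poly_Mapping.single j 1) = f i j"
  by (simp add: bilin_extend_def)

lemma bilin_extend_linear:
  "bilin_extend f (p + p') q = bilin_extend f p q + bilin_extend f p' q"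
  "bilin_extend f (c *\<^sub>c p) q = c *\<^sub>c bilin_extend f p q"
  "bilin_extend f p (q + q') = bilin_extend f p q + bilin_extend f p q'"
  "bilin_extend f p (c *\<^sub>c q) = c *\<^sub>c bilin_extend f p q"
  unfolding bilin_extend_def
  by (simp_all add: lin_extend_add lin_extend_scale)
    (simp_all add: lin_extend_def sum.distrib cs.scale_right_distrib cs.scale_sum_right
      mult.left_commute)

text \<open>The next three facts reduce identities to basis vectors: an identity between multilinear
  expressions is stated as the vanishing of their difference.\<close>

lemma linear_eq_zero_on_basis:
  assumes "Vector_Spaces.linear cscale cscale f" "\<And>i. f (Poly_Mapping.single i 1) = 0"
  shows "f p = 0"
proof -
  interpret Vector_Spaces.linear cscale cscale f by (rule assms(1))
  have "p = (\<Sum>i\<in>Poly_Mapping.keys p. Poly_Mapping.lookup p i *\<^sub>c Poly_Mapping.single i 1)"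
    by (rule poly_mapping_eqI)
      (simp add: lookup_sum lookup_single when_def if_distrib in_keys_iff cong: if_cong)
  then have "f p = (\<Sum>i\<in>Poly_Mapping.keys p. Poly_Mapping.lookup p i *\<^sub>c f (Poly_Mapping.single i 1))"
    by (metis (no_types, lifting) sum scale sum.cong)
  with assms(2) show ?thesis by simp
qed

lemma bilinear_eq_zero_on_basis:
  assumes "\<And>y. Vector_Spaces.linear cscale cscale (\<lambda>x. f x y)"
    and "\<And>x. Vector_Spaces.linear cscale cscale (f x)"
    and "\<And>i j. f (Poly_Mapping.single i 1) (Poly_Mapping.single j 1) = 0"
  shows "f p q = 0"
proof (rule linear_eq_zero_on_basis[where f = "\<lambda>x. f x q"])
  show "f (Poly_Mapping.single i 1) q = 0" for i
    using assms(2,3) by (rule linear_eq_zero_on_basis)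
qed (rule assms(1))

lemma trilinear_eq_zero_on_basis:
  assumes "\<And>y z. Vector_Spaces.linear cscale cscale (\<lambda>x. f x y z)"
    and "\<And>x z. Vector_Spaces.linear cscale cscale (\<lambda>y. f x y z)"
    and "\<And>x y. Vector_Spaces.linear cscale cscale (f x y)"
    and "\<And>i j k. f (Poly_Mapping.single i 1) (Poly_Mapping.single j 1) (Poly_Mapping.single k 1) = 0"
  shows "f p q r = 0"
proof (rule linear_eq_zero_on_basis[where f = "\<lambda>x. f x q r"])
  show "f (Poly_Mapping.single i 1) q r = 0" for i
    using assms(2-4) by (rule bilinear_eq_zero_on_basis)
qed (rule assms(1))

section \<open>The Virasoro algebra and its module of intermediate series\<close>

lemmas vir_bracket_linear = bilin_extend_linear[of vir_bracket_basis, folded vir_bracket_def]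
lemmas series_act_linear = bilin_extend_linear[of "series_act_basis \<alpha> \<beta>", folded series_act_def] for \<alpha> \<beta>

lemma vir_bracket_basis_simps [simp]:
  "vir_bracket (vir_L m) (vir_L n) = of_int (n - m) *\<^sub>c vir_L (n + m) +
     (if n = - m then (of_int (m ^ 3 - m) / 12) *\<^sub>c vir_C else 0)"
  "vir_bracket vir_C (vir_L m) = 0" "vir_bracket (vir_L m) vir_C = 0"
  "vir_bracket vir_C vir_C = 0"
  by (simp_all add: vir_bracket_def vir_L_def[of m] vir_L_def[of n] vir_C_def)

lemma series_act_basis_simps [simp]:
  "series_act \<alpha> \<beta> (vir_L i) (v_basis j) = (\<alpha> + of_int j + \<beta> * of_int i) *\<^sub>c v_basis (i + j)"
  "series_act \<alpha> \<beta> vir_C (v_basis j) = 0"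
  by (simp_all add: series_act_def vir_L_def v_basis_def[of j] vir_C_def)

lemma single_vir: "Poly_Mapping.single (L_index i) 1 = vir_L i"
  "Poly_Mapping.single C_index 1 = vir_C"
  by (simp_all add: vir_L_def vir_C_def)

lemma vir_bracket_zero [simp]: "vir_bracket 0 y = 0" "vir_bracket x 0 = 0"
  using vir_bracket_linear(2)[of 0] vir_bracket_linear(4)[of _ 0] by simp_all

lemma series_act_zero [simp]: "series_act \<alpha> \<beta> 0 y = 0" "series_act \<alpha> \<beta> x 0 = 0"
  using series_act_linear(2)[of \<alpha> \<beta> 0] series_act_linear(4)[of \<alpha> \<beta> _ 0] by simp_all

lemma vir_bracket_C [simp]: "vir_bracket vir_C x = 0" "vir_bracket x vir_C = 0"
proof -
  have "vir_bracket vir_C (Poly_Mapping.single i 1) = 0"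
    "vir_bracket (Poly_Mapping.single i 1) vir_C = 0" for i
    by (cases i; simp add: single_vir)+
  moreover have "Vector_Spaces.linear cscale cscale (vir_bracket vir_C)"
    "Vector_Spaces.linear cscale cscale (\<lambda>x. vir_bracket x vir_C)"
    by (simp_all add: linear_cscale_iff vir_bracket_linear)
  ultimately show "vir_bracket vir_C x = 0" "vir_bracket x vir_C = 0"
    using linear_eq_zero_on_basis[of "vir_bracket vir_C"]
      linear_eq_zero_on_basis[of "\<lambda>x. vir_bracket x vir_C"] by blast+
qed

lemma series_act_C [simp]: "series_act \<alpha> \<beta> vir_C v = 0"
  by (rule linear_eq_zero_on_basis[where f = "series_act \<alpha> \<beta> vir_C"])
    (simp_all add: linear_cscale_iff series_act_linear flip: v_basis_def)

text \<open>On non-basis elements \<open>[x, x] = 0\<close> is not linear in \<open>x\<close>, so it is obtained from its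
  polarized form, which is bilinear; this is enough in characteristic zero.\<close>

lemma vir_bracket_antisym: "vir_bracket x y + vir_bracket y x = 0"
proof (rule bilinear_eq_zero_on_basis[where f = "\<lambda>x y. vir_bracket x y + vir_bracket y x"])
  show "vir_bracket (Poly_Mapping.single i 1) (Poly_Mapping.single j 1)
      + vir_bracket (Poly_Mapping.single j 1) (Poly_Mapping.single i 1) = 0" for i j
    by (cases i; cases j)
      (auto simp: single_vir add.commute intro!: poly_mapping_eqI
        simp: lookup_add algebra_simps diff_divide_distrib)
qed (simp_all add: linear_cscale_iff vir_bracket_linear cs.scale_right_distrib)

text \<open>A double bracket of generators lies in the span of one \<open>L\<close> and \<open>C\<close>, and the cyclic
  permutations give the same \<open>L\<close>. So the Jacobi identity amounts to two polynomial identities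
  for integers, the central one holding on the plane \<open>i + j + k = 0\<close>.\<close>

lemma vir_jacobi_LLL:
  "vir_bracket (vir_L i) (vir_bracket (vir_L j) (vir_L k))
    + vir_bracket (vir_L j) (vir_bracket (vir_L k) (vir_L i))
    + vir_bracket (vir_L k) (vir_bracket (vir_L i) (vir_L j)) = 0"
proof -
  have double: "vir_bracket (vir_L i) (vir_bracket (vir_L j) (vir_L k)) =
     of_int ((k - j) * (k + j - i)) *\<^sub>c vir_L (k + j + i)
     + (of_int (if i + j + k = 0 then (k - j) * (i ^ 3 - i) else 0) / 12) *\<^sub>c vir_C" for i j k
  proof -
    have "k + j = - i \<longleftrightarrow> i + j + k = 0" by auto
    then show ?thesis
      by (auto simp: vir_bracket_linear cs.scale_right_distrib)
  qed
  have L: "(k - j) * (k + j - i) + (i - k) * (i + k - j) + (j - i) * (j + i - k) = 0"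
    by algebra
  have C: "(k - j) * (i ^ 3 - i) + (i - k) * (j ^ 3 - j) + (j - i) * (k ^ 3 - k) = 0"
    if "i + j + k = 0"
    using that by algebra
  have perm: "i + k + j = k + j + i" "j + i + k = k + j + i"
    "j + k + i = i + j + k" "k + i + j = i + j + k" by simp_all
  have cancel: "(x *\<^sub>c p + (y / 12) *\<^sub>c q) + (x' *\<^sub>c p + (y' / 12) *\<^sub>c q) + (x'' *\<^sub>c p + (y'' / 12) *\<^sub>c q) = 0"
    if "x + x' + x'' = 0" "y + y' + y'' = 0" for x x' x'' y y' y'' and p q :: vir
  proof -
    have "x'' = - x - x'" "y'' = - y - y'"
      using that by algebra+
    then show ?thesis
      by (simp add: cs.scale_left_distrib cs.scale_left_diff_distrib diff_divide_distrib)
  qed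
  show ?thesis
    unfolding double perm
    by (rule cancel; simp only: of_int_add[symmetric] of_int_eq_0_iff L) (use C in auto)
qed

lemma vir_jacobi:
  "vir_bracket x (vir_bracket y z) + vir_bracket y (vir_bracket z x)
    + vir_bracket z (vir_bracket x y) = 0"
proof (rule trilinear_eq_zero_on_basis[where f = "\<lambda>x y z. vir_bracket x (vir_bracket y z)
    + vir_bracket y (vir_bracket z x) + vir_bracket z (vir_bracket x y)"])
  fix i j k
  show "vir_bracket (Poly_Mapping.single i 1) (vir_bracket (Poly_Mapping.single j 1) (Poly_Mapping.single k 1))
    + vir_bracket (Poly_Mapping.single j 1) (vir_bracket (Poly_Mapping.single k 1) (Poly_Mapping.single i 1))
    + vir_bracket (Poly_Mapping.single k 1) (vir_bracket (Poly_Mapping.single i 1) (Poly_Mapping.single j 1)) = 0"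
    by (cases i; cases j; cases k)
      (simp_all only: single_vir vir_jacobi_LLL vir_bracket_C vir_bracket_zero add_0)
qed (simp_all add: linear_cscale_iff vir_bracket_linear cs.scale_right_distrib)

interpretation vir: lie_algebra cscale vir_bracket
proof unfold_locales
  show "vir_bracket x x = 0" for x
  proof (rule poly_mapping_eqI)
    show "Poly_Mapping.lookup (vir_bracket x x) i = Poly_Mapping.lookup 0 i" for i
      using arg_cong[OF vir_bracket_antisym[of x x], of "\<lambda>p. Poly_Mapping.lookup p i"]
      by (simp add: lookup_add)
  qed
qed (simp_all add: linear_cscale_iff vir_bracket_linear vir_jacobi)

text \<open>Both sides are multiples of \<open>v\<^bsub>i+j+k\<^esub>\<close>. In the commutator the terms that are symmetric in
  \<open>i\<close> and \<open>j\<close> cancel, and the rest is divisible by \<open>j - i\<close>.\<close>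

lemma series_act_bracket_LL:
  "series_act \<alpha> \<beta> (vir_bracket (vir_L i) (vir_L j)) (v_basis k)
    = series_act \<alpha> \<beta> (vir_L i) (series_act \<alpha> \<beta> (vir_L j) (v_basis k))
      - series_act \<alpha> \<beta> (vir_L j) (series_act \<alpha> \<beta> (vir_L i) (v_basis k))"
proof -
  have "series_act \<alpha> \<beta> (vir_bracket (vir_L i) (vir_L j)) (v_basis k)
      = (of_int (j - i) * (\<alpha> + of_int k + \<beta> * of_int (i + j))) *\<^sub>c v_basis (i + j + k)"
    by (auto simp: series_act_linear ac_simps)
  also have "\<dots> = ((\<alpha> + of_int k + \<beta> * of_int j) * (\<alpha> + of_int (j + k) + \<beta> * of_int i)
      - (\<alpha> + of_int k + \<beta> * of_int i) * (\<alpha> + of_int (i + k) + \<beta> * of_int j)) *\<^sub>c v_basis (i + j + k)"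
    by (rule arg_cong[where f = "\<lambda>c. c *\<^sub>c _"]) (simp add: algebra_simps)
  also have "\<dots> = series_act \<alpha> \<beta> (vir_L i) (series_act \<alpha> \<beta> (vir_L j) (v_basis k))
      - series_act \<alpha> \<beta> (vir_L j) (series_act \<alpha> \<beta> (vir_L i) (v_basis k))"
    by (simp add: series_act_linear cs.scale_left_diff_distrib ac_simps)
  finally show ?thesis .
qed

lemma series_act_bracket:
  "series_act \<alpha> \<beta> (vir_bracket x y) v
    = series_act \<alpha> \<beta> x (series_act \<alpha> \<beta> y v) - series_act \<alpha> \<beta> y (series_act \<alpha> \<beta> x v)"
proof -
  have "series_act \<alpha> \<beta> (vir_bracket x y) v
    - (series_act \<alpha> \<beta> x (series_act \<alpha> \<beta> y v) - series_act \<alpha> \<beta> y (series_act \<alpha> \<beta> x v)) = 0"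
  proof (rule trilinear_eq_zero_on_basis[where f = "\<lambda>x y v. series_act \<alpha> \<beta> (vir_bracket x y) v
    - (series_act \<alpha> \<beta> x (series_act \<alpha> \<beta> y v) - series_act \<alpha> \<beta> y (series_act \<alpha> \<beta> x v))"])
    fix i j k
    show "series_act \<alpha> \<beta> (vir_bracket (Poly_Mapping.single i 1) (Poly_Mapping.single j 1)) (Poly_Mapping.single k 1)
    - (series_act \<alpha> \<beta> (Poly_Mapping.single i 1) (series_act \<alpha> \<beta> (Poly_Mapping.single j 1) (Poly_Mapping.single k 1))
    - series_act \<alpha> \<beta> (Poly_Mapping.single j 1) (series_act \<alpha> \<beta> (Poly_Mapping.single i 1) (Poly_Mapping.single k 1))) = 0"
      by (cases i; cases j)
        (simp_all only: single_vir v_basis_def[symmetric] series_act_bracket_LL vir_bracket_C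
          series_act_C series_act_zero diff_self)
  qed (simp_all add: linear_cscale_iff vir_bracket_linear series_act_linear cs.scale_right_distrib
        cs.scale_right_diff_distrib)
  then show ?thesis by simp
qed

interpretation series: lie_module cscale vir_bracket cscale "series_act \<alpha> \<beta>" for \<alpha> \<beta>
  by unfold_locales (simp_all add: linear_cscale_iff series_act_linear series_act_bracket)

section \<open>Shifting by the identity\<close>

text \<open>Expanding the bracket on the right-hand side gives the three terms on the left and
  \<open>[x, y]\<close>.\<close>

lemma (in lie_algebra) differential_iff_endomorphism:
  "d (bracket x y) = bracket (d x) y + bracket x (d y) + bracket (d x) (d y) \<longleftrightarrow>
    d (bracket x y) + bracket x y = bracket (d x + x) (d y + y)"
proof -
  interpret l: Vector_Spaces.linear scale scale "\<lambda>x. bracket x z" for z by (rule bracket_linear_left)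
  interpret r: Vector_Spaces.linear scale scale "\<lambda>y. bracket z y" for z by (rule bracket_linear_right)
  show ?thesis by (simp add: l.add r.add algebra_simps)
qed

text \<open>The analogue for modules; \<open>y\<close> stands for \<open>d x\<close>.\<close>

lemma (in lie_module) differential_iff_semilinear:
  "\<delta> (act x v) = act y v + act x (\<delta> v) + act y (\<delta> v) \<longleftrightarrow>
    \<delta> (act x v) + act x v = act (y + x) (\<delta> v + v)"
proof -
  interpret l: Vector_Spaces.linear scaleL scaleV "\<lambda>x. act x z" for z by (rule act_linear_left)
  interpret r: Vector_Spaces.linear scaleV scaleV "\<lambda>y. act z y" for z by (rule act_linear_right)
  show ?thesis by (simp add: l.add r.add algebra_simps)
qed

definition vir_hom :: "int \<Rightarrow> complex \<Rightarrow> vir \<Rightarrow> vir"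
  where "vir_hom n a x = vir_d n a x + x"

lemma vir_d_linear:
  "vir_d n a (x + y) = vir_d n a x + vir_d n a y" "vir_d n a (c *\<^sub>c x) = c *\<^sub>c vir_d n a x"
  by (simp_all add: vir_d_def lin_extend_add lin_extend_scale)

lemma vir_hom_linear:
  "vir_hom n a (x + y) = vir_hom n a x + vir_hom n a y"
  "vir_hom n a (c *\<^sub>c x) = c *\<^sub>c vir_hom n a x"
  by (simp_all add: vir_hom_def vir_d_linear cs.scale_right_distrib)

lemma vir_hom_zero [simp]: "vir_hom n a 0 = 0"
  using vir_hom_linear(2)[of n a 0] by simp

lemma vir_hom_L:
  "vir_hom n a (vir_L i) = (a powi i / of_int n) *\<^sub>c vir_L (n * i)
     + (if i = 0 then ((1 - of_int n ^ 2) / (24 * of_int n)) *\<^sub>c vir_C else 0)"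
proof -
  have "vir_hom n a (vir_L i) = (a powi i / of_int n) *\<^sub>c
         (vir_L (n * i) - (if i = 0 then (of_int (n\<^sup>2 - 1) / 24) *\<^sub>c vir_C else 0))"
    by (simp add: vir_hom_def vir_d_def vir_L_def[of i])
  also have "\<dots> = (a powi i / of_int n) *\<^sub>c vir_L (n * i)
     + (if i = 0 then ((1 - of_int n ^ 2) / (24 * of_int n)) *\<^sub>c vir_C else 0)"
    by (auto intro!: poly_mapping_eqI simp: lookup_add lookup_minus algebra_simps diff_divide_distrib)
  finally show ?thesis .
qed

lemma vir_hom_C: "vir_hom n a vir_C = of_int n *\<^sub>c vir_C"
  by (simp add: vir_hom_def vir_d_def vir_C_def)

text \<open>The bracket ignores central terms, so only the \<open>L\<close> parts of the images matter on the
  right-hand side. If \<open>j \<noteq> -i\<close>, no central term occurs. If \<open>j = -i\<close>, the cocycle on the right is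
  \<open>(n i\<^sup>3 - i / n) / 12\<close>, whereas \<open>n\<close> times the original cocycle is \<open>n (i\<^sup>3 - i) / 12\<close>. The
  difference is linear in \<open>i\<close> and comes from the central term of the image of \<open>L\<^sub>0\<close>.\<close>

lemma vir_hom_bracket_LL:
  assumes "n \<noteq> 0" "a \<noteq> 0"
  shows "vir_hom n a (vir_bracket (vir_L i) (vir_L j))
    = vir_bracket (vir_hom n a (vir_L i)) (vir_hom n a (vir_L j))"
proof -
  have R: "vir_bracket (vir_hom n a (vir_L i)) (vir_hom n a (vir_L j))
      = (a powi i / of_int n * (a powi j / of_int n)) *\<^sub>c vir_bracket (vir_L (n * i)) (vir_L (n * j))"
    by (simp add: vir_hom_L vir_bracket_linear del: vir_bracket_basis_simps)
  show ?thesis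
  proof (cases "j = - i")
    case True
    have b: "vir_bracket (vir_L k) (vir_L (- k)) = (- 2 * of_int k) *\<^sub>c vir_L 0
        + ((of_int k ^ 3 - of_int k) / 12) *\<^sub>c vir_C" for k
      by simp
    have "vir_hom n a (vir_bracket (vir_L i) (vir_L j)) =
        (- 2 * of_int i / of_int n) *\<^sub>c vir_L 0
        + ((of_int n * of_int i ^ 3 - of_int i / of_int n) / 12) *\<^sub>c vir_C"
      unfolding True b vir_hom_linear vir_hom_L vir_hom_C using assms(1)
      by (intro poly_mapping_eqI)
        (simp add: lookup_add lookup_minus field_simps power2_eq_square power3_eq_cube)
    also have "\<dots> = (1 / of_int n ^ 2) *\<^sub>c vir_bracket (vir_L (n * i)) (vir_L (n * j))"
      unfolding True mult_minus_right b using assms(1)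
      by (intro poly_mapping_eqI)
        (simp add: lookup_add lookup_minus field_simps power2_eq_square power3_eq_cube)
    also have "a powi i * a powi j = 1"
      using assms(2) True by (simp add: power_int_minus)
    then have "(1 / of_int n ^ 2 :: complex) = a powi i / of_int n * (a powi j / of_int n)"
      by (simp add: power2_eq_square)
    finally show ?thesis unfolding R .
  next
    case False
    then have "n * j \<noteq> - (n * i)"
      using assms(1) by (metis mult_cancel_left mult_minus_right)
    moreover from False have "j + i \<noteq> 0" by simp
    moreover have "of_int (j - i) * (a powi (j + i) / of_int n)
        = a powi i / of_int n * (a powi j / of_int n) * of_int (n * j - n * i)"
      using assms \<open>j + i \<noteq> 0\<close> by (simp add: power_int_add field_simps)
    ultimately show ?thesis
      using False unfolding R
      by (simp add: vir_hom_linear vir_hom_L distrib_left del: of_int_diff of_int_mult)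
  qed
qed

lemma vir_hom_bracket:
  assumes "n \<noteq> 0" "a \<noteq> 0"
  shows "vir_hom n a (vir_bracket x y) = vir_bracket (vir_hom n a x) (vir_hom n a y)"
proof -
  have "vir_hom n a (vir_bracket x y) - vir_bracket (vir_hom n a x) (vir_hom n a y) = 0"
  proof (rule bilinear_eq_zero_on_basis[where f = "\<lambda>x y.
      vir_hom n a (vir_bracket x y) - vir_bracket (vir_hom n a x) (vir_hom n a y)"])
    show "vir_hom n a (vir_bracket (Poly_Mapping.single i 1) (Poly_Mapping.single j 1))
      - vir_bracket (vir_hom n a (Poly_Mapping.single i 1)) (vir_hom n a (Poly_Mapping.single j 1)) = 0" for i j
      by (cases i; cases j)
        (simp_all only: single_vir vir_hom_bracket_LL[OF assms] vir_bracket_C vir_hom_C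
          vir_bracket_linear vir_hom_zero cs.scale_zero_right diff_self)
  qed (simp_all add: linear_cscale_iff vir_bracket_linear vir_hom_linear
      cs.scale_right_diff_distrib)
  then show ?thesis by simp
qed

lemma vir_d_one_diff_operator:
  assumes "n \<noteq> 0" "a \<noteq> 0"
  shows "one_diff_operator cscale vir_bracket (vir_d n a)"
proof unfold_locales
  show "vir_d n a (vir_bracket x y) = vir_bracket (vir_d n a x) y + vir_bracket x (vir_d n a y)
      + vir_bracket (vir_d n a x) (vir_d n a y)" for x y
    using vir_hom_bracket[OF assms, of x y]
    by (simp add: vir.differential_iff_endomorphism vir_hom_def)
qed (simp_all add: linear_cscale_iff vir_d_linear)

section \<open>Semilinear maps of the module of intermediate series\<close>

text \<open>For a fixed linear \<open>\<delta>\<close>, semilinearity of \<open>D\<close> is a bilinear identity in \<open>x\<close> and \<open>v\<close>.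
  On \<open>C\<close> it is void, because \<open>C\<close> and its image both act by zero.\<close>

lemma one_diff_module_iff_basis:
  assumes "n \<noteq> 0" "a \<noteq> 0" and lin: "Vector_Spaces.linear cscale cscale \<delta>"
  defines "D \<equiv> \<lambda>v. \<delta> v + v"
  shows "one_diff_module cscale vir_bracket (vir_d n a) cscale (series_act \<alpha> \<beta>) \<delta> \<longleftrightarrow>
    (\<forall>i j. (\<alpha> + of_int j + \<beta> * of_int i) *\<^sub>c D (v_basis (i + j))
      = (a powi i / of_int n) *\<^sub>c series_act \<alpha> \<beta> (vir_L (n * i)) (D (v_basis j)))"
    (is "_ \<longleftrightarrow> ?B")
proof -
  have D: "D (x + y) = D x + D y" "D (c *\<^sub>c x) = c *\<^sub>c D x" for x y c
    using lin by (simp_all add: D_def linear_cscale_iff cs.scale_right_distrib)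
  have D0: "D 0 = 0"
    using D(2)[of 0] by simp
  interpret one_diff_operator cscale vir_bracket "vir_d n a"
    using assms(1,2) by (rule vir_d_one_diff_operator)
  have "one_diff_module cscale vir_bracket (vir_d n a) cscale (series_act \<alpha> \<beta>) \<delta> \<longleftrightarrow>
    (\<forall>x v. D (series_act \<alpha> \<beta> x v) = series_act \<alpha> \<beta> (vir_hom n a x) (D v))"
    unfolding one_diff_module_def one_diff_module_axioms_def D_def vir_hom_def
      series.differential_iff_semilinear
    using lin series.lie_module_axioms one_diff_operator_axioms by blast
  also have "\<dots> \<longleftrightarrow> ?B"
  proof (intro iffI allI)
    fix i j
    assume "\<forall>x v. D (series_act \<alpha> \<beta> x v) = series_act \<alpha> \<beta> (vir_hom n a x) (D v)"
    then have "D (series_act \<alpha> \<beta> (vir_L i) (v_basis j))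
        = series_act \<alpha> \<beta> (vir_hom n a (vir_L i)) (D (v_basis j))"
      by blast
    then show "(\<alpha> + of_int j + \<beta> * of_int i) *\<^sub>c D (v_basis (i + j))
        = (a powi i / of_int n) *\<^sub>c series_act \<alpha> \<beta> (vir_L (n * i)) (D (v_basis j))"
      by (simp add: D vir_hom_L series_act_linear split: if_splits)
  next
    fix x v
    assume B: ?B
    have "D (series_act \<alpha> \<beta> x v) - series_act \<alpha> \<beta> (vir_hom n a x) (D v) = 0"
    proof (rule bilinear_eq_zero_on_basis[where f = "\<lambda>x v.
        D (series_act \<alpha> \<beta> x v) - series_act \<alpha> \<beta> (vir_hom n a x) (D v)"])
      show "D (series_act \<alpha> \<beta> (Poly_Mapping.single i 1) (Poly_Mapping.single j 1))
        - series_act \<alpha> \<beta> (vir_hom n a (Poly_Mapping.single i 1)) (D (Poly_Mapping.single j 1)) = 0" for i j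
        using B
        by (cases i)
          (simp_all add: single_vir v_basis_def[symmetric] vir_hom_L vir_hom_C series_act_linear D D0)
    qed (simp_all add: linear_cscale_iff series_act_linear vir_hom_linear D
        cs.scale_right_diff_distrib)
    then show "D (series_act \<alpha> \<beta> x v) = series_act \<alpha> \<beta> (vir_hom n a x) (D v)"
      by simp
  qed
  finally show ?thesis .
qed

lemma lookup_v_basis: "Poly_Mapping.lookup (v_basis j) k = (if j = k then 1 else 0)"
  by (simp add: v_basis_def lookup_single when_def)

lemma lookup_series_act_L0:
  "Poly_Mapping.lookup (series_act \<alpha> \<beta> (vir_L 0) w) k = (\<alpha> + of_int k) * Poly_Mapping.lookup w k"
  by (simp add: series_act_def bilin_extend_def vir_L_def lin_extend_def[of _ w] lookup_sum
      lookup_v_basis if_distrib in_keys_iff mult.commute cong: if_cong)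

text \<open>If \<open>g j \<noteq> g k\<close>, the weights of \<open>(j, k)\<close> and of \<open>(k, j)\<close> both vanish, and so does their
  sum \<open>2 \<alpha> + j + k\<close>. Hence \<open>j + k\<close> is the same for all pairs on which \<open>g\<close> differs. But any third
  index \<open>l\<close> forms such a pair with \<open>j\<close> or with \<open>k\<close>, and the sum of that pair is different.\<close>

lemma constant_if_weighted_differences_vanish:
  fixes g :: "int \<Rightarrow> complex"
  assumes rel: "\<And>j k. (\<alpha> + of_int j + \<beta> * of_int (k - j)) * (g k - g j) = 0"
  shows "g j = g k"
proof (rule ccontr)
  have sum: "j + k = l + k'"
    if "g j \<noteq> g k" "g l \<noteq> g k'" for j k l k'
  proof -
    have *: "of_int (j + k) = - 2 * \<alpha>" if "g j \<noteq> g k" for j k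
    proof -
      have "\<alpha> + of_int j + \<beta> * of_int (k - j) = 0" "\<alpha> + of_int k + \<beta> * of_int (j - k) = 0"
        using rel[of j k] rel[of k j] that by auto
      then have "(\<alpha> + of_int j + \<beta> * of_int (k - j)) + (\<alpha> + of_int k + \<beta> * of_int (j - k)) = 0"
        by simp
      then have "of_int (j + k) + 2 * \<alpha> = 0"
        by (simp add: algebra_simps)
      then show ?thesis
        by (simp add: eq_neg_iff_add_eq_0)
    qed
    have "of_int (j + k) = (of_int (l + k') :: complex)"
      using *[OF that(1)] *[OF that(2)] by simp
    then show ?thesis by (simp only: of_int_eq_iff)
  qed
  assume neq: "g j \<noteq> g k"
  define l where "l = max j k + 1"
  have l: "l \<noteq> j" "l \<noteq> k" by (auto simp: l_def)
  consider "g l \<noteq> g j" | "g l \<noteq> g k" using neq by metis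
  then show False
  proof cases
    case 1
    from sum[OF neq 1] l show False by simp
  next
    case 2
    from sum[OF neq 2] l show False by simp
  qed
qed

text \<open>The classification of semilinear maps in terms of the images \<open>f i\<close> of the basis vectors.
  In both directions the key is that \<open>\<alpha> + m = n \<alpha>\<close>: it makes the weight of \<open>L\<^sub>n\<^sub>i\<close> on
  \<open>v\<^bsub>m+nj\<^esub>\<close> equal to \<open>n\<close> times the weight of \<open>L\<^sub>i\<close> on \<open>v\<^sub>j\<close>.\<close>

lemma semilinear_on_series:
  fixes f :: "int \<Rightarrow> series"
  assumes "n \<noteq> 0" "a \<noteq> 0"
  shows "(\<forall>i j. (\<alpha> + of_int j + \<beta> * of_int i) *\<^sub>c f (i + j)
      = (a powi i / of_int n) *\<^sub>c series_act \<alpha> \<beta> (vir_L (n * i)) (f j)) \<longleftrightarrow>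
    (\<exists>m::int. of_int (n - 1) * \<alpha> = of_int m \<and>
       (\<exists>\<xi>. \<forall>i. f i = (\<xi> * a powi i) *\<^sub>c v_basis (m + n * i)))
    \<or> (\<forall>i. f i = 0)" (is "?S \<longleftrightarrow> ?F \<or> ?Z")
proof (intro iffI)
  assume S: ?S
  \<comment> \<open>The case \<open>i = 0\<close>: \<open>f j\<close> is an eigenvector of \<open>L\<^sub>0\<close>.\<close>
  have support: "\<alpha> + of_int k = of_int n * (\<alpha> + of_int j)"
    if "Poly_Mapping.lookup (f j) k \<noteq> 0" for j k
  proof -
    have "(\<alpha> + of_int k - of_int n * (\<alpha> + of_int j)) * Poly_Mapping.lookup (f j) k = 0"
      using arg_cong[OF S[rule_format, of j 0], of "\<lambda>p. Poly_Mapping.lookup p k"] assms(1)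
      by (simp add: lookup_series_act_L0 lookup_add field_simps)
    with that show ?thesis by simp
  qed
  show "?F \<or> ?Z"
  proof (cases ?Z)
    case False
    then obtain j0 k0 where "Poly_Mapping.lookup (f j0) k0 \<noteq> 0"
      by (metis poly_mapping_eqI lookup_zero)
    define m where "m = k0 - n * j0"
    have m: "of_int (n - 1) * \<alpha> = of_int m"
      using support[OF \<open>Poly_Mapping.lookup (f j0) k0 \<noteq> 0\<close>] by (simp add: m_def algebra_simps)
    define c where "c j = Poly_Mapping.lookup (f j) (m + n * j)" for j
    have f: "f j = c j *\<^sub>c v_basis (m + n * j)" for j
    proof (rule poly_mapping_eqI)
      fix k
      have "k = m + n * j" if "Poly_Mapping.lookup (f j) k \<noteq> 0"
      proof -
        have "(of_int k :: complex) = of_int (m + n * j)"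
          using support[OF that] m by (simp add: algebra_simps)
        then show ?thesis by (simp only: of_int_eq_iff)
      qed
      then show "Poly_Mapping.lookup (f j) k = Poly_Mapping.lookup (c j *\<^sub>c v_basis (m + n * j)) k"
        by (auto simp: c_def lookup_v_basis)
    qed
    \<comment> \<open>Dividing by \<open>a\<^sup>j\<close> absorbs the factor \<open>a\<^sup>i\<close> between the coefficients at \<open>j\<close> and \<open>i + j\<close>.\<close>
    define g where "g j = c j / a powi j" for j
    have "(\<alpha> + of_int j + \<beta> * of_int (k - j)) * (g k - g j) = 0" for j k
    proof -
      define i where "i = k - j"
      have idx: "n * i + (m + n * j) = m + n * k" "i + j = k" by (simp_all add: i_def algebra_simps)
      have scal: "\<alpha> + of_int (m + n * j) + \<beta> * of_int (n * i)
          = of_int n * (\<alpha> + of_int j + \<beta> * of_int i)"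
        using m by (simp add: algebra_simps)
      have "(\<alpha> + of_int j + \<beta> * of_int i) * c k
          = a powi i / of_int n * (c j * (of_int n * (\<alpha> + of_int j + \<beta> * of_int i)))"
        using arg_cong[OF S[rule_format, of j i], of "\<lambda>p. Poly_Mapping.lookup p (m + n * k)"]
        by (simp only: f series_act_linear series_act_basis_simps idx scal lookup_cscale lookup_v_basis)
          simp
      also have "\<dots> = (\<alpha> + of_int j + \<beta> * of_int i) * (a powi i * c j)"
        using assms(1) by simp
      finally have "(\<alpha> + of_int j + \<beta> * of_int i) * (c k - a powi i * c j) = 0"
        by (simp only: right_diff_distrib diff_self)
      moreover have "a powi k = a powi i * a powi j"
        using assms(2) idx(2) by (metis power_int_add)
      moreover have "g k - g j = (c k - a powi i * c j) / a powi k"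
        using assms(2) calculation(2) by (simp add: g_def field_simps)
      ultimately show ?thesis unfolding i_def by (simp del: of_int_diff)
    qed
    then have const: "g j = g 0" for j
      by (rule constant_if_weighted_differences_vanish)
    have "f i = (g 0 * a powi i) *\<^sub>c v_basis (m + n * i)" for i
      using assms(2) const[of i] unfolding f[of i] by (simp add: g_def[of i] field_simps)
    with m show ?thesis by blast
  qed simp
next
  assume "?F \<or> ?Z"
  then show ?S
  proof
    assume ?F
    then obtain m \<xi> where m: "of_int (n - 1) * \<alpha> = of_int m"
      and f: "\<And>i. f i = (\<xi> * a powi i) *\<^sub>c v_basis (m + n * i)" by blast
    show ?S
    proof (intro allI)
      fix i j
      have idx: "n * i + (m + n * j) = m + n * (i + j)" by (simp add: algebra_simps)
      have scal: "\<alpha> + of_int (m + n * j) + \<beta> * of_int (n * i)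
          = of_int n * (\<alpha> + of_int j + \<beta> * of_int i)"
        using m by (simp add: algebra_simps)
      have "(\<alpha> + of_int j + \<beta> * of_int i) * (\<xi> * a powi (i + j))
          = a powi i / of_int n * (\<xi> * a powi j * (of_int n * (\<alpha> + of_int j + \<beta> * of_int i)))"
        using assms by (simp add: power_int_add)
      then show "(\<alpha> + of_int j + \<beta> * of_int i) *\<^sub>c f (i + j)
          = (a powi i / of_int n) *\<^sub>c series_act \<alpha> \<beta> (vir_L (n * i)) (f j)"
        by (simp only: f series_act_linear series_act_basis_simps idx scal cs.scale_scale mult.assoc)
    qed
  qed simp
qed

theorem theorem3p6:
  fixes n :: int and a \<alpha> \<beta> :: complex and \<delta> :: "series \<Rightarrow> series"
  assumes "n \<noteq> 0" and "a \<noteq> 0"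
    and "Vector_Spaces.linear cscale cscale \<delta>"
  shows "one_diff_module cscale vir_bracket (vir_d n a) cscale (series_act \<alpha> \<beta>) \<delta> \<longleftrightarrow>
    (\<exists>m::int. of_int (n - 1) * \<alpha> = of_int m \<and>
       (\<exists>\<xi>. \<forall>i. \<delta> (v_basis i) = (\<xi> * a powi i) *\<^sub>c v_basis (m + n * i) - v_basis i))
    \<or> (\<forall>w. \<delta> w = - w)"
proof -
  have "\<delta> w + w = 0" if "\<forall>i. \<delta> (v_basis i) + v_basis i = 0" for w
  proof (rule linear_eq_zero_on_basis[where f = "\<lambda>w. \<delta> w + w"])
    show "Vector_Spaces.linear cscale cscale (\<lambda>w. \<delta> w + w)"
      using assms(3) by (simp add: linear_cscale_iff cs.scale_right_distrib)
  qed (use that in \<open>simp flip: v_basis_def\<close>)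
  then have zero: "(\<forall>i. \<delta> (v_basis i) + v_basis i = 0) \<longleftrightarrow> (\<forall>w. \<delta> w = - w)"
    by (auto simp: eq_neg_iff_add_eq_0)
  show ?thesis
    using one_diff_module_iff_basis[OF assms, of \<alpha> \<beta>]
      semilinear_on_series[OF assms(1,2), of \<alpha> \<beta> "\<lambda>i. \<delta> (v_basis i) + v_basis i"]
    by (simp only: zero eq_diff_eq)
qed

end
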